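(* Let $B\in M_n(\mathbb K)$ be a matrix, and let $S=\{\lambda\in\mathbb K \mid \dim\ker(B-\lambda I)>1\}$ be the set of eigenvalues $\lambda$ of $B$ for which there is more than one Jordan cell with eigenvalue $\lambda$. Then $B$ is integrable if and only if an integral (antiderivative) $\int p_B(x)\,dx\in\mathbb K[x]$ of the characteristic polynomial $p_B$ takes the same value at all elements of $S$.
   Context: $\mathbb K$ is an algebraically closed subfield of $\mathbb C$; $M_n(\mathbb K)$ is the set of $n\times n$ matrices over $\mathbb K$; $\mathbb K^n$ is the set of row vectors of length $n$. For a square matrix $X$, $p_X(x)=\det(xI-X)$ is its characteristic polynomial. For $B\in M_n(\mathbb K)$, a matrix $A\in M_{n+1}(\mathbb K)$ is called an integral of $B$ if there exist $u,v\in\mathbb K^n$ and $b\in\mathbb K$ such that $A=\begin{pmatrix} B & u^{\top}\\ v & b\end{pmatrix}$ and $p_B(x)=\frac{1}{n+1}p_A'(x)$. The matrix $B$ is integrable if there exists an integral of $B$. *)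

theory Defs
  imports
    "Jordan_Normal_Form.Char_Poly"
    "Jordan_Normal_Form.Matrix_Kernel"
begin

(* The ground field K, a subfield of the complex numbers, is the whole type 'a; in the theorem its
   embedding into complex is given by a field homomorphism. Determinants, K[x] and dimensions of
   kernels are thereby all taken over K. *)

(* Vectors of Matrix.thy carry no orientation; mat_of_row u is the row vector u as a 1 x n matrix. *)

definition bordered_mat :: "'a::field mat \<Rightarrow> 'a vec \<Rightarrow> 'a vec \<Rightarrow> 'a \<Rightarrow> 'a mat" where
  "bordered_mat B u v b =
     four_block_mat B (transpose_mat (mat_of_row u))
                    (mat_of_row v) (mat 1 1 (\<lambda>_. b))"

definition is_integral_of :: "nat \<Rightarrow> 'a::field mat \<Rightarrow> 'a mat \<Rightarrow> bool" where
  "is_integral_of n B A \<longleftrightarrow>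
     A \<in> carrier_mat (n + 1) (n + 1) \<and>
     (\<exists>u v b. u \<in> carrier_vec n \<and> v \<in> carrier_vec n \<and> A = bordered_mat B u v b) \<and>
     char_poly B = Polynomial.smult (1 / of_nat (n + 1)) (pderiv (char_poly A))"

definition integrable_mat :: "nat \<Rightarrow> 'a::field mat \<Rightarrow> bool" where
  "integrable_mat n B \<longleftrightarrow> (\<exists>A. is_integral_of n B A)"

definition multi_cell_eigenvalues :: "nat \<Rightarrow> 'a::field mat \<Rightarrow> 'a set" where
  "multi_cell_eigenvalues n B = {c. kernel_dim (B - c \<cdot>\<^sub>m 1\<^sub>m n) > 1}"

end

theory Submission
  imports Defs "Jordan_Normal_Form.DL_Rank" "Jordan_Normal_Form.Jordan_Normal_Form_Uniqueness"
    "Jordan_Normal_Form.Jordan_Normal_Form_Existence"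
begin

text \<open>For a bordered matrix \<open>A\<close> of \<open>B\<close> one has
  \<open>p_A = (x - b) p_B - v adj(xI - B) u\<close>. If \<open>ker(B - cI)\<close> has dimension at least 2, it contains a
  nonzero vector orthogonal to \<open>v\<close>, so \<open>c\<close> is a root of every such \<open>p_A\<close>; hence an antiderivative
  of the form \<open>p_A / (n + 1)\<close> vanishes on \<open>S\<close>.

  Conversely, normalise \<open>(n + 1) P\<close> by a constant to a \<open>q\<close> vanishing on \<open>S\<close>. As
  \<open>q' = (n + 1) p_B\<close>, at each \<open>c \<in> S\<close> the order of \<open>q\<close> is at least that of \<open>p_B\<close>. For suitable
  \<open>b\<close> the remainder \<open>r = (x - b) p_B - q\<close> has degree below \<open>n\<close>, and \<open>r / p_B\<close> has no pole in
  \<open>S\<close>. So \<open>u\<close> and \<open>v\<close> may vanish on the generalised eigenspaces for \<open>S\<close>; every other eigenvalue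
  has a single Jordan cell, which realises an arbitrary principal part, and partial fractions give
  \<open>v adj(xI - B) u = r\<close>.\<close>

section \<open>Triangularisation and Jordan form over an algebraically closed field\<close>

text \<open>The columns of \<open>P\<close> are a basis that completes \<open>v\<close>; their
  independence gives full rank, hence a nonzero determinant and an inverse.\<close>

lemma exists_invertible_first_col:
  fixes v :: "'a::field vec"
  assumes v: "v \<in> carrier_vec n" and v0: "v \<noteq> 0\<^sub>v n"
  shows "\<exists>P Q. P \<in> carrier_mat n n \<and> Q \<in> carrier_mat n n \<and> P * Q = 1\<^sub>m n \<and> Q * P = 1\<^sub>m n
    \<and> P *\<^sub>v unit_vec n 0 = v"
proof -
  interpret vec_space "TYPE('a)" n .
  let ?b = "basis_completion v"
  note b = basis_completion[OF v v0]
  define P where "P = mat_of_cols n ?b"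
  have P: "P \<in> carrier_mat n n" using b(6) unfolding P_def by auto
  have cols: "cols P = ?b" unfolding P_def using b(2) by (intro cols_mat_of_cols) auto
  have n0: "0 < n" using v v0 by (cases n) auto
  have "rank P = n" using lin_indpt_full_rank[OF P] b(4,5) unfolding cols by auto
  with det_rank_iff[OF P] have "det P \<noteq> 0" by simp
  from det_non_zero_imp_unit[OF P \<open>det P \<noteq> 0\<close>, unfolded Units_def, of "()"]
  obtain Q where Q: "Q \<in> carrier_mat n n" "Q * P = 1\<^sub>m n" "P * Q = 1\<^sub>m n"
    by (auto simp: ring_mat_def)
  have "P *\<^sub>v unit_vec n 0 = col P 0"
    using P n0 by (intro eq_vecI) auto
  also have "\<dots> = ?b ! 0"
    using cols P n0 by (metis carrier_matD(2) cols_nth)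
  also have "\<dots> = v"
    using b(6,7) n0 by (metis hd_conv_nth length_greater_0_conv)
  finally show ?thesis using P Q by blast
qed

text \<open>Deflation: a change of basis moves an eigenvector to the first unit vector, which clears
  the first column below the diagonal; the induction hypothesis then triangularises the lower right
  block.\<close>

lemma similar_upper_triangular_exists:
  fixes A :: "'a::alg_closed_field mat"
  assumes "A \<in> carrier_mat n n"
  shows "\<exists>T. T \<in> carrier_mat n n \<and> upper_triangular T \<and> similar_mat A T"
  using assms
proof (induction n arbitrary: A)
  case 0
  then show ?case by (intro exI[of _ A]) (auto intro: similar_mat_refl simp: upper_triangular_def)
next
  case (Suc n)
  note A = Suc.prems
  have "degree (char_poly A) > 0" using degree_monic_char_poly[OF A] by simp
  from alg_closed_imp_poly_has_root[OF this] obtain e where "eigenvalue A e"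
    using eigenvalue_root_char_poly[OF A] by auto
  then obtain v where v: "v \<in> carrier_vec (Suc n)" "v \<noteq> 0\<^sub>v (Suc n)" "A *\<^sub>v v = e \<cdot>\<^sub>v v"
    using A unfolding eigenvalue_def eigenvector_def by auto
  from exists_invertible_first_col[OF v(1,2)] obtain P Q where
    PQ: "P \<in> carrier_mat (Suc n) (Suc n)" "Q \<in> carrier_mat (Suc n) (Suc n)"
      "P * Q = 1\<^sub>m (Suc n)" "Q * P = 1\<^sub>m (Suc n)" and Pv: "P *\<^sub>v unit_vec (Suc n) 0 = v" by blast
  define A' where "A' = Q * A * P"
  have A': "A' \<in> carrier_mat (Suc n) (Suc n)" using PQ A unfolding A'_def by auto
  have "similar_mat_wit A' A Q P"
    by (rule similar_mat_witI[OF PQ(4,3)]) (use PQ A A' in \<open>auto simp: A'_def\<close>)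
  then have simA: "similar_mat A A'" unfolding similar_mat_def using similar_mat_wit_sym by blast
  have u: "unit_vec (Suc n) 0 \<in> carrier_vec (Suc n)" by simp
  have QA: "Q * A \<in> carrier_mat (Suc n) (Suc n)" using PQ A by auto
  have "A' *\<^sub>v unit_vec (Suc n) 0 = (Q * A) *\<^sub>v v"
    unfolding A'_def Pv[symmetric] by (rule assoc_mult_mat_vec[OF QA PQ(1) u])
  also have "\<dots> = Q *\<^sub>v (A *\<^sub>v v)" by (rule assoc_mult_mat_vec[OF PQ(2) A v(1)])
  also have "\<dots> = e \<cdot>\<^sub>v (Q *\<^sub>v v)" unfolding v(3) using PQ(2) v(1) by (rule mult_mat_vec)
  also have "Q *\<^sub>v v = (Q * P) *\<^sub>v unit_vec (Suc n) 0"
    unfolding Pv[symmetric] by (rule assoc_mult_mat_vec[OF PQ(2,1) u, symmetric])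
  also have "\<dots> = unit_vec (Suc n) 0" unfolding PQ by simp
  finally have A'u: "A' *\<^sub>v unit_vec (Suc n) 0 = e \<cdot>\<^sub>v unit_vec (Suc n) 0" .
  have col0: "A' $$ (i, 0) = 0" if "0 < i" "i < Suc n" for i
    using arg_cong[OF A'u, of "\<lambda>w. w $ i"] that A' by auto
  obtain A1 A0 Z A2 where sp: "split_block A' 1 1 = (A1, A0, Z, A2)"
    by (metis prod_cases4)
  have "dim_row A' = 1 + n" "dim_col A' = 1 + n" using A' by auto
  note sb = split_block[OF sp this]
  have Z: "Z = 0\<^sub>m n 1"
    using sp sb(3) A' col0 unfolding split_block_def Let_def by (intro eq_matI) auto
  from Suc.IH[OF sb(4)] obtain T where T: "T \<in> carrier_mat n n" "upper_triangular T" "similar_mat A2 T"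
    by blast
  \<comment> \<open>The similarity of \<open>A2\<close> and \<open>T\<close> extends to the whole
    matrix at the price of a new upper right block \<open>B0\<close>, whose entries do not affect
    triangularity.\<close>
  from similar_mat_four_block_0_ex[OF similar_mat_refl[OF sb(1)] T(3) sb(2,1,4)]
  obtain B0 where B0: "B0 \<in> carrier_mat 1 n"
    "similar_mat (four_block_mat A1 A0 (0\<^sub>m n 1) A2) (four_block_mat A1 B0 (0\<^sub>m n 1) T)" by blast
  have "upper_triangular A1" using sb(1) by (auto simp: upper_triangular_def)
  then have "upper_triangular (four_block_mat A1 B0 (0\<^sub>m n 1) T)"
    using upper_triangular_four_block[OF sb(1) T(1) _ T(2)] by blast
  moreover have "four_block_mat A1 B0 (0\<^sub>m n 1) T \<in> carrier_mat (Suc n) (Suc n)"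
    using four_block_carrier_mat[OF sb(1) T(1)] by simp
  moreover have "similar_mat A (four_block_mat A1 B0 (0\<^sub>m n 1) T)"
    using similar_mat_trans[OF simA] B0(2) sb(5) Z by simp
  ultimately show ?case by blast
qed

lemma jordan_nf_exists_alg_closed:
  fixes A :: "'a::alg_closed_field mat"
  assumes "A \<in> carrier_mat n n"
  shows "\<exists>ns. jordan_nf A ns"
  using similar_upper_triangular_exists[OF assms] triangular_to_jnf_vector similar_mat_trans
  unfolding jordan_nf_def by blast

section \<open>Kernel vectors orthogonal to a given vector\<close>

text \<open>Pairing with \<open>v\<close> is a linear functional on the kernel of \<open>A\<close>.
  If it were injective there, one vector would span the kernel, against \<open>dim\<close>.\<close>

lemma exists_kernel_vec_orthogonal:
  fixes A :: "'a::field mat"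
  assumes A: "A \<in> carrier_mat n n" and v: "v \<in> carrier_vec n" and dim: "kernel_dim A > 1"
  shows "\<exists>w. w \<in> carrier_vec n \<and> w \<noteq> 0\<^sub>v n \<and> A *\<^sub>v w = 0\<^sub>v n \<and> v \<bullet> w = 0"
proof (rule ccontr)
  assume neg: "\<not> ?thesis"
  interpret kernel n n A by unfold_locales (rule A)
  have inner0: "w = 0\<^sub>v n" if "w \<in> mat_kernel A" "v \<bullet> w = 0" for w
    using neg that mat_kernelD[OF A] by blast
  have "\<exists>x. x \<in> mat_kernel A \<and> span {x} = mat_kernel A"
  proof (cases "\<exists>x \<in> mat_kernel A. v \<bullet> x \<noteq> 0")
    case True
    then obtain x where x: "x \<in> mat_kernel A" "v \<bullet> x \<noteq> 0" by blast
    have xc: "x \<in> carrier_vec n" using mat_kernelD[OF A x(1)] by simp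
    have "w \<in> span {x}" if w: "w \<in> mat_kernel A" for w
    proof -
      \<comment> \<open>This multiple of \<open>x\<close> has the same pairing with \<open>v\<close>
        as \<open>w\<close>, so the difference is a kernel vector orthogonal to \<open>v\<close> and
        hence zero.\<close>
      define c where "c = (v \<bullet> w) / (v \<bullet> x)"
      have wc: "w \<in> carrier_vec n" using mat_kernelD[OF A w] by simp
      have cx: "c \<cdot>\<^sub>v x \<in> mat_kernel A" using mat_kernel_smult[OF A x(1)] .
      have "A *\<^sub>v (w - c \<cdot>\<^sub>v x) = 0\<^sub>v n"
        using mult_minus_distrib_mat_vec[OF A wc, of "c \<cdot>\<^sub>v x"] xc
          mat_kernelD[OF A w] mat_kernelD[OF A cx] by simp
      then have "w - c \<cdot>\<^sub>v x \<in> mat_kernel A"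
        using wc xc by (intro mat_kernelI[OF A]) auto
      moreover have "v \<bullet> (w - c \<cdot>\<^sub>v x) = 0"
        using v wc xc x(2) by (simp add: scalar_prod_minus_distrib[of _ n] c_def)
      ultimately have "w - c \<cdot>\<^sub>v x = 0\<^sub>v n" by (rule inner0)
      then have "w = c \<cdot>\<^sub>v x" using wc xc
        by (intro eq_vecI) (auto simp: vec_eq_iff)
      moreover have "c \<cdot>\<^sub>v x \<in> span {x}"
        using submodule.smult_closed[OF Ker.span_is_submodule[of "{x}"], of c x]
          Ker.in_own_span[of "{x}"] x(1) by (auto simp: class_ring_simps)
      ultimately show ?thesis by simp
    qed
    then have "mat_kernel A \<subseteq> span {x}" by (rule subsetI)
    then have "span {x} = mat_kernel A" using x(1) Ker.span_is_subset2[of "{x}"]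
      by (simp add: subset_antisym)
    with x(1) show ?thesis by (intro exI conjI)
  next
    case False
    \<comment> \<open>The functional vanishes on the kernel, so by \<open>inner0\<close> the kernel
      is trivial and the zero vector spans it.\<close>
    have z: "0\<^sub>v n \<in> mat_kernel A" using A by (intro mat_kernelI) auto
    have "w \<in> span {0\<^sub>v n}" if w: "w \<in> mat_kernel A" for w
      using inner0[OF w] False w Ker.in_own_span[of "{0\<^sub>v n}"] z by auto
    then have "mat_kernel A \<subseteq> span {0\<^sub>v n}" by (rule subsetI)
    then have "span {0\<^sub>v n} = mat_kernel A" using z Ker.span_is_subset2[of "{0\<^sub>v n}"]
      by (simp add: subset_antisym)
    with z show ?thesis by (intro exI conjI)
  qed
  then obtain x where "x \<in> mat_kernel A" "span {x} = mat_kernel A" by (elim exE conjE)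
  then have "dim \<le> 1" by (intro Ker.dim_le1I)
  with dim show False by simp
qed

section \<open>Characteristic polynomials of bordered matrices\<close>

abbreviation const_vec :: "'a::zero vec \<Rightarrow> 'a poly vec" where
  "const_vec \<equiv> map_vec (\<lambda>a. [:a:])"

lemma bordered_mat_carrier:
  assumes "B \<in> carrier_mat n n" "u \<in> carrier_vec n" "v \<in> carrier_vec n"
  shows "bordered_mat B u v b \<in> carrier_mat (n + 1) (n + 1)"
  using assms unfolding bordered_mat_def by auto

text \<open>The Schur complement formula with denominators cleared. The equation \<open>Bw\<close>
  characterises adj(xI - B) u, so an explicit \<open>w\<close> can be supplied without computing an
  adjugate. The determinants give the claim multiplied by p_B, which is monic and cancels.\<close>

lemma char_poly_bordered_mat:
  fixes B :: "'a::field mat"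
  assumes B: "B \<in> carrier_mat n n" and u: "u \<in> carrier_vec n" and v: "v \<in> carrier_vec n"
    and w: "w \<in> carrier_vec n"
    and Bw: "char_poly_matrix B *\<^sub>v w = char_poly B \<cdot>\<^sub>v const_vec u"
  shows "char_poly (bordered_mat B u v b) = [:- b, 1:] * char_poly B - const_vec v \<bullet> w"
proof -
  let ?M = "char_poly_matrix B" and ?p = "char_poly B"
  let ?U = "mat n 1 (\<lambda>(i, j). [:- (u $ i):])" and ?V = "mat 1 n (\<lambda>(i, j). [:- (v $ j):])"
  let ?D = "mat 1 1 (\<lambda>_. [:- b, 1:])"
  let ?W = "mat n 1 (\<lambda>(i, j). w $ i)" and ?P = "mat 1 1 (\<lambda>_. ?p)"
  \<comment> \<open>Multiplying by \<open>?X\<close> clears the column \<open>u\<close>, so the product is block triangular.\<close>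
  let ?N = "four_block_mat ?M ?U ?V ?D" and ?X = "four_block_mat (1\<^sub>m n) ?W (0\<^sub>m 1 n) ?P"
  have M: "?M \<in> carrier_mat n n" using B by simp
  have N: "char_poly_matrix (bordered_mat B u v b) = ?N"
    unfolding char_poly_matrix_def bordered_mat_def using B u v
    by (intro eq_matI) (auto simp: mat_of_row_def)
  have MW: "(?M * ?W) $$ (i, 0) = ?p * [:u $ i:]" if "i < n" for i
  proof -
    have "(?M * ?W) $$ (i, 0) = (?M *\<^sub>v w) $ i"
      using that M w by (auto simp: scalar_prod_def intro!: sum.cong)
    then show ?thesis using Bw that u by simp
  qed
  have VW: "(?V * ?W) $$ (0, 0) = - (const_vec v \<bullet> w)"
    using v w by (auto simp: scalar_prod_def sum_negf[symmetric] intro!: sum.cong)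
  let ?R = "four_block_mat ?M (0\<^sub>m n 1) ?V (mat 1 1 (\<lambda>_. [:- b, 1:] * ?p - const_vec v \<bullet> w))"
  have "?N * ?X = four_block_mat (?M * 1\<^sub>m n + ?U * 0\<^sub>m 1 n) (?M * ?W + ?U * ?P)
      (?V * 1\<^sub>m n + ?D * 0\<^sub>m 1 n) (?V * ?W + ?D * ?P)"
    using M by (intro mult_four_block_mat) auto
  also have "\<dots> = ?R"
  proof (rule cong_four_block_mat)
    show "?M * 1\<^sub>m n + ?U * 0\<^sub>m 1 n = ?M" using M by (simp add: right_add_zero_mat)
    show "?V * 1\<^sub>m n + ?D * 0\<^sub>m 1 n = ?V" by (simp add: right_add_zero_mat)
    show "?M * ?W + ?U * ?P = 0\<^sub>m n 1"
    proof (rule eq_matI)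
      fix i j assume ij: "i < dim_row (0\<^sub>m n 1 :: 'a poly mat)" "j < dim_col (0\<^sub>m n 1 :: 'a poly mat)"
      then have "(?U * ?P) $$ (i, j) = - (?p * [:u $ i:])"
        by (simp add: scalar_prod_def)
      then show "(?M * ?W + ?U * ?P) $$ (i, j) = 0\<^sub>m n 1 $$ (i, j)"
        using ij MW M by simp
    qed (use M in auto)
    show "?V * ?W + ?D * ?P = mat 1 1 (\<lambda>_. [:- b, 1:] * ?p - const_vec v \<bullet> w)"
    proof (rule eq_matI)
      fix i j assume "i < dim_row (mat 1 1 (\<lambda>_. [:- b, 1:] * ?p - const_vec v \<bullet> w))"
        "j < dim_col (mat 1 1 (\<lambda>_. [:- b, 1:] * ?p - const_vec v \<bullet> w))"
      then show "(?V * ?W + ?D * ?P) $$ (i, j)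
          = mat 1 1 (\<lambda>_. [:- b, 1:] * ?p - const_vec v \<bullet> w) $$ (i, j)"
        using VW by (simp add: scalar_prod_def)
    qed auto
  qed
  finally have "det ?N * det ?X = det ?R"
    using det_mult[of ?N "n + 1" ?X] four_block_carrier_mat[OF M, of ?D 1 1]
      four_block_carrier_mat[OF one_carrier_mat, of ?P 1 1 n] by simp
  moreover have "det ?X = ?p"
    by (subst det_four_block_mat_lower_left_zero[of _ n _ 1]) (auto simp: det_single)
  moreover have "det ?R = ?p * ([:- b, 1:] * ?p - const_vec v \<bullet> w)"
    using M by (subst det_four_block_mat_upper_right_zero[of _ n _ 1]) (auto simp: det_single char_poly_def)
  ultimately have "?p * char_poly (bordered_mat B u v b) = ?p * ([:- b, 1:] * ?p - const_vec v \<bullet> w)"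
    unfolding char_poly_def[of "bordered_mat B u v b"] N by (simp add: mult.commute)
  moreover have "?p \<noteq> 0" using degree_monic_char_poly[OF B] by auto
  ultimately show ?thesis using mult_left_cancel by blast
qed

text \<open>Conjugation by diag(P, 1) turns \<open>u\<close> into P u and \<open>v\<close> into the
  transpose of Q applied to \<open>v\<close>, leaving \<open>b\<close> fixed. Borders may thus be
  constructed for the Jordan form and carried back to \<open>B\<close>.\<close>

lemma similar_mat_bordered_mat:
  fixes B :: "'a::field mat"
  assumes B: "B \<in> carrier_mat n n" and sim: "similar_mat B J"
    and u: "u \<in> carrier_vec n" and v: "v \<in> carrier_vec n"
  shows "\<exists>u' v'. u' \<in> carrier_vec n \<and> v' \<in> carrier_vec n \<and>
    (\<forall>b. similar_mat (bordered_mat B u' v' b) (bordered_mat J u v b))"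
proof -
  from sim obtain P Q where wit: "similar_mat_wit B J P Q" unfolding similar_mat_def by blast
  note PQ = similar_mat_witD2[OF B wit]
  let ?u = "P *\<^sub>v u" and ?v = "Q\<^sup>T *\<^sub>v v"
  have "similar_mat (bordered_mat B ?u ?v b) (bordered_mat J u v b)" for b
  proof -
    have bb: "mat 1 1 (\<lambda>_. b) \<in> carrier_mat 1 1" by simp
    have "(mat_of_row ?u)\<^sup>T = P * (mat_of_row u)\<^sup>T * 1\<^sub>m 1"
      using PQ(6) u by (intro eq_matI) (auto simp: mat_of_row_def scalar_prod_def intro!: sum.cong)
    moreover have "mat_of_row ?v = 1\<^sub>m 1 * mat_of_row v * Q"
      using PQ(7) v by (intro eq_matI) (auto simp: mat_of_row_def scalar_prod_def mult.commute intro!: sum.cong)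
    ultimately show ?thesis
      unfolding bordered_mat_def similar_mat_def
      using similar_mat_wit_four_block[OF wit similar_mat_wit_refl[OF bb] _ _ B bb,
          of "(mat_of_row ?u)\<^sup>T" "(mat_of_row u)\<^sup>T" "mat_of_row ?v" "mat_of_row v"] u v
      by fastforce
  qed
  then show ?thesis using PQ u v by (intro exI[of _ ?u] exI[of _ ?v]) auto
qed

section \<open>Polynomials realisable as v adj(xI - B) u\<close>

text \<open>The polynomials \<open>r = v adj(xI - B) u\<close>, the vector \<open>w\<close> standing for \<open>adj(xI - B) u\<close>.\<close>

definition transfer_numerator :: "'a::field mat \<Rightarrow> 'a poly \<Rightarrow> bool" where
  "transfer_numerator B r \<longleftrightarrow>
    (\<exists>u \<in> carrier_vec (dim_row B). \<exists>v \<in> carrier_vec (dim_row B). \<exists>w \<in> carrier_vec (dim_row B).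
      char_poly_matrix B *\<^sub>v w = char_poly B \<cdot>\<^sub>v const_vec u \<and> const_vec v \<bullet> w = r)"

lemma transfer_numerator_zero:
  assumes "B \<in> carrier_mat n n"
  shows "transfer_numerator B 0"
proof -
  have "char_poly_matrix B *\<^sub>v 0\<^sub>v n = char_poly B \<cdot>\<^sub>v const_vec (0\<^sub>v n)"
    using assms by (intro eq_vecI) (auto simp: char_poly_matrix_def)
  then show ?thesis
    using assms unfolding transfer_numerator_def by (auto intro!: bexI[of _ "0\<^sub>v n"])
qed

lemma const_vec_append: "const_vec (a @\<^sub>v b) = const_vec a @\<^sub>v const_vec b"
  by (intro eq_vecI) auto

lemma char_poly_matrix_block_diag:
  fixes A1 A2 :: "'a::field mat"
  assumes "A1 \<in> carrier_mat n n" "A2 \<in> carrier_mat m m"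
  shows "char_poly_matrix (four_block_mat A1 (0\<^sub>m n m) (0\<^sub>m m n) A2) =
    four_block_mat (char_poly_matrix A1) (0\<^sub>m n m) (0\<^sub>m m n) (char_poly_matrix A2)"
  unfolding char_poly_matrix_def using assms by (intro eq_matI) auto

text \<open>The fractions r / p add over a direct sum, here written over the common denominator p1
  p2. Accordingly each part of \<open>w\<close> is scaled by the characteristic polynomial of the
  other block.\<close>

lemma transfer_numerator_block_diag:
  fixes A1 A2 :: "'a::field mat"
  assumes A: "A1 \<in> carrier_mat n n" "A2 \<in> carrier_mat m m"
    and r: "transfer_numerator A1 r1" "transfer_numerator A2 r2"
  shows "transfer_numerator (four_block_mat A1 (0\<^sub>m n m) (0\<^sub>m m n) A2)
    (r1 * char_poly A2 + r2 * char_poly A1)"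
proof -
  let ?A = "four_block_mat A1 (0\<^sub>m n m) (0\<^sub>m m n) A2"
  let ?p1 = "char_poly A1" and ?p2 = "char_poly A2"
  from r(1) A obtain u1 v1 w1 where 1: "u1 \<in> carrier_vec n" "v1 \<in> carrier_vec n" "w1 \<in> carrier_vec n"
    "char_poly_matrix A1 *\<^sub>v w1 = ?p1 \<cdot>\<^sub>v const_vec u1" "const_vec v1 \<bullet> w1 = r1"
    unfolding transfer_numerator_def by auto
  from r(2) A obtain u2 v2 w2 where 2: "u2 \<in> carrier_vec m" "v2 \<in> carrier_vec m" "w2 \<in> carrier_vec m"
    "char_poly_matrix A2 *\<^sub>v w2 = ?p2 \<cdot>\<^sub>v const_vec u2" "const_vec v2 \<bullet> w2 = r2"
    unfolding transfer_numerator_def by auto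
  let ?w = "(?p2 \<cdot>\<^sub>v w1) @\<^sub>v (?p1 \<cdot>\<^sub>v w2)"
  have M: "char_poly_matrix A1 \<in> carrier_mat n n" "char_poly_matrix A2 \<in> carrier_mat m m" using A by auto
  have smult: "C *\<^sub>v (k \<cdot>\<^sub>v x) = k \<cdot>\<^sub>v (C *\<^sub>v x)"
    if "C \<in> carrier_mat l l" "x \<in> carrier_vec l" for C :: "'a poly mat" and k x l
    using that by (intro eq_vecI) auto
  have p: "char_poly ?A = ?p1 * ?p2"
    unfolding char_poly_def char_poly_matrix_block_diag[OF A]
    using M by (intro det_four_block_mat_lower_left_zero[of _ n _ m]) auto
  have "char_poly_matrix ?A *\<^sub>v ?w
      = (char_poly_matrix A1 *\<^sub>v (?p2 \<cdot>\<^sub>v w1)) @\<^sub>v (char_poly_matrix A2 *\<^sub>v (?p1 \<cdot>\<^sub>v w2))"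
    unfolding char_poly_matrix_block_diag[OF A]
    using 1 2 by (intro mult_mat_vec_split[OF M]) auto
  also have "\<dots> = char_poly ?A \<cdot>\<^sub>v const_vec (u1 @\<^sub>v u2)"
    unfolding p smult[OF M(1) 1(3)] smult[OF M(2) 2(3)] 1(4) 2(4) const_vec_append
    using 1 2 by (intro eq_vecI) (auto simp: append_vec_def mult.commute)
  finally have "char_poly_matrix ?A *\<^sub>v ?w = char_poly ?A \<cdot>\<^sub>v const_vec (u1 @\<^sub>v u2)" .
  moreover have "const_vec (v1 @\<^sub>v v2) \<bullet> ?w = r1 * ?p2 + r2 * ?p1"
    unfolding const_vec_append using 1 2
    by (subst scalar_prod_append[of _ n _ m]) auto
  ultimately show ?thesis
    using 1 2 A unfolding transfer_numerator_def
    by (intro bexI[of _ "u1 @\<^sub>v u2"] bexI[of _ "v1 @\<^sub>v v2"] bexI[of _ ?w] conjI) auto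
qed

text \<open>With X = x - a and w = (1, X, ..., X^(k-1)), every row of (xI - J) w cancels except the
  last, which gives X^k = p_J; so \<open>u\<close> is the last unit vector. The entries of
  \<open>v\<close> then form an arbitrary polynomial in X of degree below \<open>k\<close>.\<close>

lemma transfer_numerator_jordan_block:
  fixes a :: "'a::field"
  assumes deg: "r = 0 \<or> degree r < k"
  shows "transfer_numerator (jordan_block k a) r"
proof (cases k)
  case 0
  then show ?thesis using deg transfer_numerator_zero[OF jordan_block_carrier] by simp
next
  case (Suc m)
  let ?X = "[:- a, 1:]" and ?J = "jordan_block k a"
  \<comment> \<open>The coefficients of \<open>g\<close> are those of the expansion of
    \<open>r\<close> in powers of x - a; they become the entries of \<open>v\<close>.\<close>
  define g where "g = pcompose r [:a, 1:]"
  define w where "w = vec k (\<lambda>i. ?X ^ i)"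
  have "degree g \<le> m" using deg Suc unfolding g_def by (auto simp: degree_pcompose)
  then have "g = (\<Sum>i\<le>m. monom (coeff g i) i)" by (rule poly_as_sum_of_monoms'[symmetric])
  then have "pcompose g ?X = (\<Sum>i\<le>m. pcompose (monom (coeff g i) i) ?X)"
    by (metis (no_types, lifting) pcompose_sum sum.cong)
  also have "\<dots> = (\<Sum>i\<le>m. [:coeff g i:] * ?X ^ i)"
    by (intro sum.cong refl) (simp add: monom_altdef pcompose_smult pcompose_hom.hom_power pcompose_pCons)
  also have "\<dots> = const_vec (vec k (coeff g)) \<bullet> w"
    unfolding w_def scalar_prod_def by (auto simp: Suc atLeast0LessThan lessThan_Suc_atMost intro!: sum.cong)
  finally have "const_vec (vec k (coeff g)) \<bullet> w = pcompose g ?X" ..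
  also have "\<dots> = r" unfolding g_def pcompose_assoc[symmetric] by (simp add: pcompose_pCons)
  finally have 1: "const_vec (vec k (coeff g)) \<bullet> w = r" .
  have M: "char_poly_matrix ?J $$ (i, j) = (if i = j then ?X else if j = Suc i then - 1 else 0)"
    if "i < k" "j < k" for i j
    using that unfolding char_poly_matrix_def by (auto simp: one_pCons)
  have "char_poly_matrix ?J *\<^sub>v w = char_poly ?J \<cdot>\<^sub>v const_vec (unit_vec k m)"
  proof (rule eq_vecI)
    fix i assume "i < dim_vec (char_poly ?J \<cdot>\<^sub>v const_vec (unit_vec k m))"
    then have i: "i < k" by simp
    have "(char_poly_matrix ?J *\<^sub>v w) $ i = (\<Sum>j<k. char_poly_matrix ?J $$ (i, j) * w $ j)"
      using i by (auto simp: scalar_prod_def w_def char_poly_matrix_def atLeast0LessThan intro!: sum.cong)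
    also have "\<dots> = (\<Sum>j<k. (if j = i then ?X ^ Suc i else 0) + (if j = Suc i then - (?X ^ Suc i) else 0))"
      using i by (intro sum.cong refl) (simp add: M w_def)
    also have "\<dots> = (if i = m then ?X ^ k else 0)"
      using i Suc by (simp add: sum.distrib)
    also have "\<dots> = (char_poly ?J \<cdot>\<^sub>v const_vec (unit_vec k m)) $ i"
      using i Suc by (simp add: jordan_block_char_poly)
    finally show "(char_poly_matrix ?J *\<^sub>v w) $ i = (char_poly ?J \<cdot>\<^sub>v const_vec (unit_vec k m)) $ i" .
  qed (simp add: char_poly_matrix_def)
  with 1 show ?thesis unfolding transfer_numerator_def
    by (intro bexI[of _ "unit_vec k m"] bexI[of _ "vec k (coeff g)"] bexI[of _ w] conjI) (auto simp: w_def)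
qed

section \<open>Powers of linear polynomials and partial fractions\<close>

lemma linear_power_dvd_mult_cancel:
  fixes a :: "'a::field"
  assumes "poly p a \<noteq> 0" and "[:- a, 1:] ^ m dvd p * g"
  shows "[:- a, 1:] ^ m dvd g"
proof (cases "g = 0")
  case False
  have "Polynomial.order a p = 0" using assms(1) by (simp add: order_root)
  moreover have "p * g \<noteq> 0" using assms(1) False by auto
  ultimately show ?thesis using assms(2) order_mult[of p g a] by (simp add: order_divides)
qed simp

text \<open>Scale \<open>p\<close> to y with y(a) = 1. Then x - a divides 1 - y, so (1 - y)^k is a
  multiple of (x - a)^k, while 1 - (1 - y)^k is a multiple of y by the geometric sum.\<close>

lemma linear_power_bezout:
  fixes a :: "'a::field"
  assumes "poly p a \<noteq> 0"
  shows "\<exists>s t. s * p + t * [:- a, 1:] ^ k = 1"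
proof -
  have "[:- a, 1:] dvd p - [:poly p a:]" by (simp add: poly_eq_0_iff_dvd[symmetric])
  then obtain h where h: "p - [:poly p a:] = [:- a, 1:] * h" by (elim dvdE)
  let ?c = "[:inverse (poly p a):]"
  let ?y = "?c * p"
  have "1 - ?y = - (?c * (p - [:poly p a:]))" using assms by (simp add: algebra_simps one_pCons)
  also have "\<dots> = [:- a, 1:] * (- (?c * h))" unfolding h by (simp only: mult_minus_right mult.left_commute)
  finally have y: "1 - ?y = [:- a, 1:] * (- (?c * h))" .
  have "z dvd 1 - (1 - z) ^ k" for z :: "'a poly"
    using power_diff_sumr2[of 1 k "1 - z"] by simp
  from this[of ?y] obtain s where "1 - (1 - ?y) ^ k = ?y * s" by (elim dvdE)
  then have "(?c * s) * p + (- (?c * h)) ^ k * [:- a, 1:] ^ k = 1"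
    unfolding y power_mult_distrib by (simp add: algebra_simps)
  then show ?thesis by blast
qed

text \<open>The Bezout identity is multiplied by \<open>r\<close> and the cofactor of
  \<open>p\<close> reduced modulo (x - a)^k; comparing degrees then bounds \<open>g\<close>. The
  alternatives with 0 are needed because the zero polynomial has degree 0, which is not below a size
  of 0.\<close>

lemma partial_fraction_linear_power:
  fixes a :: "'a::field"
  assumes pa: "poly p a \<noteq> 0" and deg: "r = 0 \<or> degree r < k + degree p"
  shows "\<exists>f g. r = f * p + g * [:- a, 1:] ^ k \<and> (f = 0 \<or> degree f < k) \<and> (g = 0 \<or> degree g < degree p)"
proof -
  let ?X = "[:- a, 1:] ^ k"
  from linear_power_bezout[OF pa] obtain s t where st: "s * p + t * ?X = 1" by blast
  define f where "f = (r * s) mod ?X"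
  \<comment> \<open>The quotient left over from the reduction of \<open>f\<close> is absorbed
    here.\<close>
  define g where "g = r * t + ((r * s) div ?X) * p"
  have X: "?X \<noteq> 0" "degree ?X = k" by (auto simp: degree_linear_power)
  have "r = r * (s * p + t * ?X)" unfolding st by simp
  also have "\<dots> = ((r * s) div ?X * ?X + (r * s) mod ?X) * p + r * t * ?X"
    by (simp add: algebra_simps)
  also have "\<dots> = f * p + g * ?X" unfolding f_def g_def by (simp only: algebra_simps)
  finally have eq: "r = f * p + g * ?X" .
  have f: "f = 0 \<or> degree f < k" using degree_mod_less[OF X(1), of "r * s"] X(2) unfolding f_def by simp
  have "degree g < degree p" if g: "g \<noteq> 0"
  proof -
    have p: "p \<noteq> 0" using pa by auto
    have "f * p = 0 \<or> degree (f * p) < k + degree p"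
      using f p by (cases "f = 0") (auto simp: degree_mult_eq)
    moreover have "g * ?X = r - f * p" using eq by simp
    moreover have "g * ?X \<noteq> 0" using g X by simp
    ultimately have "degree (g * ?X) < k + degree p"
      using deg by (metis degree_diff_less degree_minus diff_0 diff_zero)
    then show ?thesis using g X by (simp add: degree_mult_eq)
  qed
  with eq f show ?thesis by blast
qed

section \<open>Realisation on a Jordan matrix\<close>

text \<open>In a Jordan form with positive block sizes, the length of this list is the geometric
  multiplicity of \<open>c\<close> and the sum of its sizes the algebraic one.\<close>

abbreviation blocks_of :: "'a \<Rightarrow> (nat \<times> 'a) list \<Rightarrow> (nat \<times> 'a) list" where
  "blocks_of c ns \<equiv> filter (\<lambda>(k, e). e = c) ns"

lemma linear_power_blocks_dvd_char_poly:
  fixes ns :: "(nat \<times> 'a::field) list"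
  shows "[:- c, 1:] ^ sum_list (map fst (blocks_of c ns)) dvd char_poly (jordan_matrix ns)"
  unfolding jordan_matrix_char_poly
  by (induction ns) (auto simp: power_add intro: mult_dvd_mono dvd_mult)

lemma poly_char_poly_jordan_matrix_nonzero:
  fixes ns :: "(nat \<times> 'a::field) list"
  assumes "blocks_of c ns = []"
  shows "poly (char_poly (jordan_matrix ns)) c \<noteq> 0"
  using assms unfolding jordan_matrix_char_poly
  by (induction ns) (auto simp: poly_power split: if_splits)

text \<open>Induction over the blocks. A block whose eigenvalue does not recur later realises the
  part of r / p split off by partial fractions; a block whose eigenvalue recurs gets numerator 0,
  the divisibility hypothesis cancelling its power from \<open>r\<close>.\<close>

lemma transfer_numerator_jordan_matrix:
  fixes ns :: "(nat \<times> 'a::field) list"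
  assumes "r = 0 \<or> degree r < sum_list (map fst ns)"
    and "\<And>c. length (blocks_of c ns) > 1 \<Longrightarrow>
      [:- c, 1:] ^ sum_list (map fst (blocks_of c ns)) dvd r"
  shows "transfer_numerator (jordan_matrix ns) r"
  using assms
proof (induction ns arbitrary: r)
  case Nil
  then show ?case using transfer_numerator_zero[OF jordan_matrix_carrier] by auto
next
  case (Cons ka ns)
  obtain k a where ka: "ka = (k, a)" by force
  let ?X = "[:- a, 1:] ^ k" and ?p = "char_poly (jordan_matrix ns)"
  let ?n = "sum_list (map fst ns)"
  have degp: "degree ?p = ?n" using degree_monic_char_poly[OF jordan_matrix_carrier] by auto
  have X: "?X \<noteq> 0" "degree ?X = k" by (auto simp: degree_linear_power)
  have neq: "poly ?X c \<noteq> 0" if "c \<noteq> a" for c using that by (simp add: poly_power)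
  have step: "transfer_numerator (jordan_matrix (ka # ns)) (f * ?p + g * ?X)"
    if "transfer_numerator (jordan_block k a) f" "transfer_numerator (jordan_matrix ns) g" for f g
    using transfer_numerator_block_diag[OF jordan_block_carrier jordan_matrix_carrier that]
    unfolding ka jordan_matrix_Cons jordan_block_char_poly .
  show ?case
  proof (cases "blocks_of a ns = []")
    case False
    then have len: "length (blocks_of a (ka # ns)) > 1" unfolding ka by simp
    have "[:- a, 1:] ^ (k + sum_list (map fst (blocks_of a ns))) dvd r"
      using Cons.prems(2)[OF len] unfolding ka by simp
    then have dvd: "?X * [:- a, 1:] ^ sum_list (map fst (blocks_of a ns)) dvd r"
      by (simp add: power_add)
    then obtain g where g: "r = ?X * g" by (meson dvd_mult_left dvdE)
    have "transfer_numerator (jordan_matrix ns) g"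
    proof (rule Cons.IH)
      show "g = 0 \<or> degree g < ?n"
        using Cons.prems(1) X unfolding g ka by (cases "g = 0") (auto simp: degree_mult_eq)
      fix c assume c: "length (blocks_of c ns) > 1"
      show "[:- c, 1:] ^ sum_list (map fst (blocks_of c ns)) dvd g"
      proof (cases "c = a")
        case True
        then show ?thesis using dvd X(1) unfolding g by (metis dvd_times_left_cancel_iff)
      next
        case False
        then have "[:- c, 1:] ^ sum_list (map fst (blocks_of c ns)) dvd ?X * g"
          using Cons.prems(2)[of c] c unfolding ka g by auto
        then show ?thesis using linear_power_dvd_mult_cancel[OF neq[OF False]] by blast
      qed
    qed
    from step[OF transfer_numerator_zero[OF jordan_block_carrier] this] show ?thesis
      unfolding g by (simp add: mult.commute)
  next
    case True
    have "r = 0 \<or> degree r < k + degree ?p" using Cons.prems(1) unfolding degp ka by simp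
    from partial_fraction_linear_power[OF poly_char_poly_jordan_matrix_nonzero[OF True] this]
    obtain f g where fg: "r = f * ?p + g * ?X" "f = 0 \<or> degree f < k" "g = 0 \<or> degree g < ?n"
      unfolding degp by blast
    have "transfer_numerator (jordan_matrix ns) g"
    proof (rule Cons.IH[OF fg(3)])
      fix c assume c: "length (blocks_of c ns) > 1"
      with True have ca: "c \<noteq> a" by auto
      \<comment> \<open>The power of x - c already divides \<open>?p\<close>, so removing the part
        at \<open>a\<close> keeps the divisibility of \<open>r\<close>.\<close>
      have "[:- c, 1:] ^ sum_list (map fst (blocks_of c ns)) dvd r - f * ?p"
        using Cons.prems(2)[of c] c ca linear_power_blocks_dvd_char_poly[of c ns] unfolding ka
        by (intro dvd_diff dvd_mult) auto
      then have "[:- c, 1:] ^ sum_list (map fst (blocks_of c ns)) dvd ?X * g"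
        unfolding fg(1) by (simp add: mult.commute)
      then show "[:- c, 1:] ^ sum_list (map fst (blocks_of c ns)) dvd g"
        using linear_power_dvd_mult_cancel[OF neq[OF ca]] by blast
    qed
    from step[OF transfer_numerator_jordan_block[OF fg(2)] this] show ?thesis unfolding fg(1) .
  qed
qed

section \<open>Eigenvalues with several Jordan cells\<close>

lemma minus_smult_one_eq_char_matrix:
  fixes B :: "'a::field mat"
  assumes "B \<in> carrier_mat n n"
  shows "B - c \<cdot>\<^sub>m 1\<^sub>m n = char_matrix B c"
  unfolding char_matrix_def using assms by (intro eq_matI) auto

text \<open>A block of size k for \<open>c\<close> contributes min 1 k to the dimension of the
  kernel, and this is 1 since block sizes are positive.\<close>

lemma multi_cell_eigenvalues_iff:
  assumes B: "B \<in> carrier_mat n n" and jnf: "jordan_nf B ns"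
  shows "c \<in> multi_cell_eigenvalues n B \<longleftrightarrow> length (blocks_of c ns) > 1"
proof -
  note cm = minus_smult_one_eq_char_matrix[OF B]
  have "0 \<notin> fst ` set ns" using jnf unfolding jordan_nf_def by simp
  then have *: "sum_list (map (min (Suc 0)) (map fst (blocks_of c ns))) = length (blocks_of c ns)"
    by (induction ns) (auto simp: min_def)
  have "kernel_dim (char_matrix B c) = dim_gen_eigenspace B c 1"
    unfolding dim_gen_eigenspace_def using B by simp
  also have "\<dots> = length (blocks_of c ns)"
    unfolding dim_gen_eigenspace[OF jnf] using * by simp
  finally show ?thesis unfolding multi_cell_eigenvalues_def by (simp add: cm)
qed

text \<open>An eigenvector of \<open>B\<close> orthogonal to \<open>v\<close>, padded by a zero, is
  an eigenvector of the bordered matrix: the zero suppresses \<open>u\<close> and \<open>b\<close>,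
  orthogonality the last entry.\<close>

lemma poly_char_poly_bordered_mat_multi_cell:
  fixes B :: "'a::field mat"
  assumes B: "B \<in> carrier_mat n n" and u: "u \<in> carrier_vec n" and v: "v \<in> carrier_vec n"
    and c: "c \<in> multi_cell_eigenvalues n B"
  shows "poly (char_poly (bordered_mat B u v b)) c = 0"
proof -
  let ?A = "bordered_mat B u v b"
  have C: "B - c \<cdot>\<^sub>m 1\<^sub>m n \<in> carrier_mat n n" using B by (intro minus_carrier_mat) auto
  from exists_kernel_vec_orthogonal[OF C v] c
  obtain w where w: "w \<in> carrier_vec n" "w \<noteq> 0\<^sub>v n" "(B - c \<cdot>\<^sub>m 1\<^sub>m n) *\<^sub>v w = 0\<^sub>v n" "v \<bullet> w = 0"
    unfolding multi_cell_eigenvalues_def by blast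
  note cm = minus_smult_one_eq_char_matrix[OF B]
  have "eigenvector B w c" unfolding eigenvector_char_matrix[OF B] using w cm by simp
  then have Bw: "B *\<^sub>v w = c \<cdot>\<^sub>v w" unfolding eigenvector_def by simp
  let ?w = "w @\<^sub>v 0\<^sub>v 1"
  have A: "?A \<in> carrier_mat (n + 1) (n + 1)" by (rule bordered_mat_carrier[OF B u v])
  have "?A *\<^sub>v ?w = (B *\<^sub>v w + (mat_of_row u)\<^sup>T *\<^sub>v 0\<^sub>v 1) @\<^sub>v (mat_of_row v *\<^sub>v w + mat 1 1 (\<lambda>_. b) *\<^sub>v 0\<^sub>v 1)"
    unfolding bordered_mat_def using B u v w(1) by (intro four_block_mat_mult_vec) auto
  also have "B *\<^sub>v w + (mat_of_row u)\<^sup>T *\<^sub>v 0\<^sub>v 1 = c \<cdot>\<^sub>v w"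
    unfolding Bw using u w(1) by (intro eq_vecI) (auto simp: scalar_prod_def)
  also have "mat_of_row v *\<^sub>v w + mat 1 1 (\<lambda>_. b) *\<^sub>v 0\<^sub>v 1 = 0\<^sub>v 1"
    using v w(4) by (intro eq_vecI) auto
  also have "c \<cdot>\<^sub>v w @\<^sub>v 0\<^sub>v 1 = c \<cdot>\<^sub>v ?w" by (intro eq_vecI) auto
  finally have "?A *\<^sub>v ?w = c \<cdot>\<^sub>v ?w" .
  moreover have "?w \<noteq> 0\<^sub>v (n + 1)"
  proof
    assume w0: "?w = 0\<^sub>v (n + 1)"
    have "w $ i = 0" if "i < n" for i
      using that w(1) arg_cong[OF w0, of "\<lambda>x. x $ i"] by simp
    then show False using w(1,2) by (metis carrier_vecD eq_vecI index_zero_vec)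
  qed
  moreover have "?w \<in> carrier_vec (n + 1)" using w(1) by (intro append_carrier_vec) auto
  ultimately have "eigenvalue ?A c"
    using A unfolding eigenvalue_def eigenvector_def by (intro exI[of _ ?w]) auto
  then show ?thesis using eigenvalue_root_char_poly[OF A] by simp
qed

section \<open>Characteristic zero and multiplicities of roots\<close>

lemma of_nat_neq_0_if_hom:
  fixes \<iota> :: "'k::field \<Rightarrow> complex"
  assumes "field_hom \<iota>" "m > 0"
  shows "(of_nat m :: 'k) \<noteq> 0"
proof
  interpret field_hom \<iota> by (rule assms)
  assume "(of_nat m :: 'k) = 0"
  then have "\<iota> (of_nat m) = 0" by simp
  then have "(of_nat m :: complex) = 0" by (simp add: hom_of_nat)
  with \<open>m > 0\<close> show False by simp
qed

text \<open>The root \<open>c\<close> gives the first factor X = x - c. If q = X^m s with m > 0,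
  then q' = X^m s' + m X^(m-1) s, so X^m dividing q' forces X to divide m s, and hence s as m is
  nonzero in the field.\<close>

lemma linear_power_dvd_if_dvd_pderiv:
  fixes q :: "'a::field poly"
  assumes char0: "\<And>m. m > 0 \<Longrightarrow> (of_nat m :: 'a) \<noteq> 0"
    and q: "poly q c = 0" and "[:- c, 1:] ^ m dvd pderiv q"
  shows "[:- c, 1:] ^ m dvd q"
  using assms(3)
proof (induction m)
  case (Suc m)
  let ?X = "[:- c, 1:]"
  show ?case
  proof (cases m)
    case 0
    then show ?thesis using q by (simp add: poly_eq_0_iff_dvd)
  next
    case (Suc l)
    from Suc.prems have pd: "?X ^ m dvd pderiv q" using power_le_dvd by (metis le_SucI order_refl)
    from Suc.IH[OF pd] obtain s where s: "q = ?X ^ m * s" by (elim dvdE)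
    have "pderiv q = ?X ^ m * pderiv s + s * (Polynomial.smult (of_nat m) (?X ^ l) * pderiv ?X)"
      unfolding s pderiv_mult Suc by (simp only: pderiv_power_Suc)
    also have "pderiv ?X = 1" by (simp add: pderiv_pCons)
    finally have "pderiv q = ?X ^ m * pderiv s + ?X ^ l * Polynomial.smult (of_nat m) s"
      by (simp add: algebra_simps)
    then have "?X ^ m dvd ?X ^ l * Polynomial.smult (of_nat m) s"
      using pd by (metis dvd_add_right_iff dvd_triv_left)
    then have "?X ^ l * ?X dvd ?X ^ l * Polynomial.smult (of_nat m) s" unfolding Suc power_Suc2 .
    moreover have "?X ^ l \<noteq> 0" by simp
    ultimately have "?X dvd Polynomial.smult (of_nat m) s" by (metis dvd_times_left_cancel_iff)
    then have "?X dvd s" using char0[of m] Suc by (simp add: dvd_smult_iff)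
    then show ?thesis unfolding s by (simp only: power_Suc2 mult_dvd_mono dvd_refl)
  qed
qed simp

section \<open>Integrability through antiderivatives of the characteristic polynomial\<close>

theorem theorem2p1:
  fixes \<iota> :: "'k::alg_closed_field \<Rightarrow> complex"
    and B :: "'k mat"
    and n :: nat
  assumes "field_hom \<iota>"
    and "B \<in> carrier_mat n n"
  shows "integrable_mat n B \<longleftrightarrow>
    (\<exists>P. pderiv P = char_poly B \<and>
       (\<forall>c \<in> multi_cell_eigenvalues n B. \<forall>d \<in> multi_cell_eigenvalues n B.
          poly P c = poly P d))"
proof
  let ?S = "multi_cell_eigenvalues n B" and ?p = "char_poly B"
  note B = assms(2)
  have char0: "(of_nat m :: 'k) \<noteq> 0" if "m > 0" for m
    using of_nat_neq_0_if_hom[OF assms(1) that] .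
  let ?N = "of_nat (n + 1) :: 'k"
  have N: "?N \<noteq> 0" by (rule char0) simp
  {
    assume "integrable_mat n B"
    then obtain u v b where uv: "u \<in> carrier_vec n" "v \<in> carrier_vec n"
      and p: "?p = Polynomial.smult (1 / ?N) (pderiv (char_poly (bordered_mat B u v b)))"
      unfolding integrable_mat_def is_integral_of_def by blast
    let ?P = "Polynomial.smult (1 / ?N) (char_poly (bordered_mat B u v b))"
    have "pderiv ?P = ?p" unfolding p by (simp only: pderiv_smult)
    moreover have "poly ?P c = poly ?P d" if "c \<in> ?S" "d \<in> ?S" for c d
      using poly_char_poly_bordered_mat_multi_cell[OF B uv that(1)]
        poly_char_poly_bordered_mat_multi_cell[OF B uv that(2)] by simp
    ultimately show "\<exists>P. pderiv P = ?p \<and> (\<forall>c \<in> ?S. \<forall>d \<in> ?S. poly P c = poly P d)"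
      by (intro exI[of _ ?P] conjI ballI)
  }
  assume "\<exists>P. pderiv P = ?p \<and> (\<forall>c \<in> ?S. \<forall>d \<in> ?S. poly P c = poly P d)"
  then obtain P where P: "pderiv P = ?p" and eq: "\<And>c d. c \<in> ?S \<Longrightarrow> d \<in> ?S \<Longrightarrow> poly P c = poly P d"
    by blast
  \<comment> \<open>The common value on \<open>?S\<close>; if \<open>?S\<close> is empty this is an
    arbitrary value and the next fact is vacuous.\<close>
  define y where "y = poly P (SOME c. c \<in> ?S)"
  have y: "poly P c = y" if "c \<in> ?S" for c
    unfolding y_def by (rule eq[OF that someI[where P = "\<lambda>c. c \<in> ?S", OF that]])
  \<comment> \<open>The factor n + 1 makes \<open>q\<close> monic of degree n + 1, as the
    characteristic polynomial of a bordered matrix must be.\<close>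
  define q where "q = Polynomial.smult ?N (P - [:y:])"
  have q': "pderiv q = Polynomial.smult ?N ?p"
    unfolding q_def by (simp only: pderiv_smult pderiv_diff pderiv_singleton P diff_0_right)
  have q0: "poly q c = 0" if "c \<in> ?S" for c unfolding q_def using y[OF that] by simp
  note mon = degree_monic_char_poly[OF B]
  have coeffq: "of_nat (Suc i) * coeff q (Suc i) = ?N * coeff ?p i" for i
    using arg_cong[OF q', of "\<lambda>x. coeff x i"] by (simp only: coeff_pderiv coeff_smult)
  have lead: "coeff q (Suc n) = 1"
    using coeffq[of n] mon N by simp
  have high: "coeff q (Suc i) = 0" if "i > n" for i
    using coeffq[of i] that mon char0[of "Suc i"] by (simp add: coeff_eq_0)
  \<comment> \<open>As \<open>?p\<close> is monic of degree \<open>n\<close>, subtracting b p_B from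
    x p_B - q removes exactly the coefficient at x^n.\<close>
  define b where "b = coeff (pCons 0 ?p - q) n"
  define r where "r = [:- b, 1:] * ?p - q"
  have "coeff r i = 0" if i: "i \<ge> n" for i
  proof -
    have r: "r = (pCons 0 ?p - q) - Polynomial.smult b ?p" unfolding r_def by simp
    show ?thesis
    proof (cases "i = n")
      case True
      then show ?thesis using mon by (simp add: r b_def)
    next
      case False
      then obtain j where j: "i = Suc j" "n \<le> j" using i by (cases i) auto
      \<comment> \<open>Above x^n the polynomials x p_B and \<open>q\<close> agree: both have
        coefficient 1 at x^(n+1) and 0 beyond.\<close>
      have "coeff q i = coeff ?p j"
        using j mon lead high[of j] by (cases "j = n") (simp_all add: coeff_eq_0)
      moreover have "coeff ?p i = 0" using j mon by (intro coeff_eq_0) simp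
      ultimately show ?thesis using j by (simp add: r)
    qed
  qed
  then have degr: "r = 0 \<or> degree r < n"
    by (metis leading_coeff_0_iff not_le)
  from jordan_nf_exists_alg_closed[OF B] obtain ns where jnf: "jordan_nf B ns" by blast
  let ?J = "jordan_matrix ns"
  have sim: "similar_mat B ?J" using jnf unfolding jordan_nf_def by simp
  have pJ: "char_poly ?J = ?p" using char_poly_similar[OF sim] by simp
  have n: "sum_list (map fst ns) = n"
    using degree_monic_char_poly[OF jordan_matrix_carrier[of ns]] mon unfolding pJ by simp
  have J: "?J \<in> carrier_mat n n" using jordan_matrix_carrier[of ns] unfolding n .
  have "transfer_numerator ?J r"
  proof (rule transfer_numerator_jordan_matrix)
    show "r = 0 \<or> degree r < sum_list (map fst ns)" using degr unfolding n .
    fix c assume "length (blocks_of c ns) > 1"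
    then have c: "c \<in> ?S" using multi_cell_eigenvalues_iff[OF B jnf] by simp
    let ?m = "sum_list (map fst (blocks_of c ns))"
    have dvd: "[:- c, 1:] ^ ?m dvd ?p" using linear_power_blocks_dvd_char_poly[of c ns] unfolding pJ .
    then have "[:- c, 1:] ^ ?m dvd q"
      using linear_power_dvd_if_dvd_pderiv[OF char0 q0[OF c]] unfolding q' by (simp add: dvd_smult)
    with dvd show "[:- c, 1:] ^ ?m dvd r" unfolding r_def by (intro dvd_diff dvd_mult)
  qed
  then obtain u v w where uvw: "u \<in> carrier_vec n" "v \<in> carrier_vec n" "w \<in> carrier_vec n"
    "char_poly_matrix ?J *\<^sub>v w = char_poly ?J \<cdot>\<^sub>v const_vec u" "const_vec v \<bullet> w = r"
    unfolding transfer_numerator_def using J by auto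
  \<comment> \<open>The choice of \<open>r\<close> was made for this: (x - b) p_B - r = q.\<close>
  have "char_poly (bordered_mat ?J u v b) = q"
    unfolding char_poly_bordered_mat[OF J uvw(1-4)] pJ uvw(5) r_def by simp
  moreover from similar_mat_bordered_mat[OF B sim uvw(1,2)]
  obtain u' v' where uv': "u' \<in> carrier_vec n" "v' \<in> carrier_vec n"
    "similar_mat (bordered_mat B u' v' b) (bordered_mat ?J u v b)" by blast
  ultimately have "char_poly (bordered_mat B u' v' b) = q" using char_poly_similar by metis
  then have "?p = Polynomial.smult (1 / ?N) (pderiv (char_poly (bordered_mat B u' v' b)))"
    using q' N by simp
  then show "integrable_mat n B"
    unfolding integrable_mat_def is_integral_of_def
    using bordered_mat_carrier[OF B uv'(1,2)] uv' by blast
qed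

end
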